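(* Let $n\ge1$ and let $\hat a(z)=z^n+a_1z^{n-1}+\cdots+a_n$ and $\hat c(z)=z^n+c_1z^{n-1}+\cdots+c_n$ be real polynomials all of whose zeros lie in the open unit disc; put $\theta=(a_1,\dots,a_n,c_1,\dots,c_n)$. Let $e_P=\begin{pmatrix}Pe\\0\end{pmatrix}\in\mathbb{R}^{2n}$ and let $H(\theta)$ and $Q(\theta)$ be the unique solutions of the Stein equations $$H=F_MHF_M^\top+e_Pe_P^\top,\qquad Q=G_NQG_N^\top+e_Pe_P^\top,$$ where $$F_M=\begin{pmatrix}P(J-ea^\top)P&0\\ (c-a)e^\top&PJP-ce^\top\end{pmatrix},\qquad G_N=\begin{pmatrix}P(J-ea^\top)P&0\\ e e^\top&J-ec^\top\end{pmatrix}.$$ Then $Q(\theta)$ is strictly positive definite. Moreover, $$H(\theta)=\begin{pmatrix}I&0\\0&B(c,a)\end{pmatrix}Q(\theta)\begin{pmatrix}I&0\\0&B(c,a)\end{pmatrix}.$$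
   Context: $a(z)=z^n\hat a(z^{-1})=1+a_1z+\cdots+a_nz^n$ and $c(z)=z^n\hat c(z^{-1})$; the same letters denote the column vectors $a=(a_1,\dots,a_n)^\top$, $c=(c_1,\dots,c_n)^\top$. $e$ is the first standard basis vector of $\mathbb{R}^n$; $J$ is the $n\times n$ matrix with $J_{ij}=1$ if $i=j+1$ and $0$ otherwise; $P$ is the $n\times n$ anti-diagonal identity, $P_{ij}=\delta_{i,n+1-j}$; $I$ is the $n\times n$ identity. With $u_n(z)=(1,z,\dots,z^{n-1})^\top$, the Bezout matrix $B(c,a)$ is the $n\times n$ matrix defined by $c(z)a(w)-c(w)a(z)=(z-w)\,u_n(z)^\top B(c,a)u_n(w)$. *)

theory Defs
  imports Complex_Main "HOL-Computational_Algebra.Polynomial" "Jordan_Normal_Form.Matrix"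
begin

text \<open>
  Coefficient vectors are 0-based: the entry \<open>a $ (i - 1)\<close> is the coefficient $a_i$, for
  $1 \le i \le n$ with \<open>n = dim_vec a\<close>. Likewise row/column $i$ of a matrix has index \<open>i - 1\<close>.
\<close>

definition hat_poly :: "real vec \<Rightarrow> real poly" where
  "hat_poly a = monom 1 (dim_vec a) + (\<Sum>i = 1..dim_vec a. monom (a $ (i - 1)) (dim_vec a - i))"

definition rev_poly :: "real vec \<Rightarrow> real poly" where
  "rev_poly a = 1 + (\<Sum>i = 1..dim_vec a. monom (a $ (i - 1)) i)"

definition zeros_in_unit_disc :: "real poly \<Rightarrow> bool" where
  "zeros_in_unit_disc p \<longleftrightarrow> (\<forall>z :: complex. poly (map_poly of_real p) z = 0 \<longrightarrow> norm z < 1)"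

definition outer :: "real vec \<Rightarrow> real vec \<Rightarrow> real mat" where
  "outer u v = mat (dim_vec u) (dim_vec v) (\<lambda>(i, j). u $ i * v $ j)"

definition shift_mat :: "nat \<Rightarrow> real mat" where
  "shift_mat n = mat n n (\<lambda>(i, j). if i = j + 1 then 1 else 0)"

text \<open>With 0-based indices the anti-diagonal $j = n + 1 - i$ is \<open>i + j + 1 = n\<close>.\<close>

definition antidiag_mat :: "nat \<Rightarrow> real mat" where
  "antidiag_mat n = mat n n (\<lambda>(i, j). if i + j + 1 = n then 1 else 0)"

definition power_vec :: "nat \<Rightarrow> real \<Rightarrow> real vec" where
  "power_vec n z = vec n (\<lambda>i. z ^ i)"

definition is_bezout_mat :: "nat \<Rightarrow> real poly \<Rightarrow> real poly \<Rightarrow> real mat \<Rightarrow> bool" where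
  "is_bezout_mat n p q B \<longleftrightarrow> B \<in> carrier_mat n n \<and>
     (\<forall>z w. poly p z * poly q w - poly p w * poly q z
            = (z - w) * (power_vec n z \<bullet> (B *\<^sub>v power_vec n w)))"

text \<open>Well defined when both degrees are at most \<open>n\<close>; see \<open>ex1_bezout_mat\<close>.\<close>

definition bezout_mat :: "nat \<Rightarrow> real poly \<Rightarrow> real poly \<Rightarrow> real mat" where
  "bezout_mat n p q = (THE B. is_bezout_mat n p q B)"

definition e_P :: "nat \<Rightarrow> real vec" where
  "e_P n = (antidiag_mat n *\<^sub>v unit_vec n 0) @\<^sub>v 0\<^sub>v n"

definition F_M :: "nat \<Rightarrow> real vec \<Rightarrow> real vec \<Rightarrow> real mat" where
  "F_M n a c = (let J = shift_mat n; P = antidiag_mat n; e = unit_vec n 0 in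
     four_block_mat
       (P * (J - outer e a) * P)  (0\<^sub>m n n)
       (outer (c - a) e)          (P * J * P - outer c e))"

definition G_N :: "nat \<Rightarrow> real vec \<Rightarrow> real vec \<Rightarrow> real mat" where
  "G_N n a c = (let J = shift_mat n; P = antidiag_mat n; e = unit_vec n 0 in
     four_block_mat
       (P * (J - outer e a) * P)  (0\<^sub>m n n)
       (outer e e)                (J - outer e c))"

definition stein_solution :: "real mat \<Rightarrow> real vec \<Rightarrow> real mat \<Rightarrow> bool" where
  "stein_solution F g X \<longleftrightarrow> X \<in> carrier_mat (dim_vec g) (dim_vec g) \<and>
     X = F * X * transpose_mat F + outer g g"

definition H_mat :: "nat \<Rightarrow> real vec \<Rightarrow> real vec \<Rightarrow> real mat" where
  "H_mat n a c = (THE H. stein_solution (F_M n a c) (e_P n) H)"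

definition Q_mat :: "nat \<Rightarrow> real vec \<Rightarrow> real vec \<Rightarrow> real mat" where
  "Q_mat n a c = (THE Q. stein_solution (G_N n a c) (e_P n) Q)"

definition pos_definite :: "real mat \<Rightarrow> bool" where
  "pos_definite A \<longleftrightarrow> (\<exists>m. A \<in> carrier_mat m m) \<and> transpose_mat A = A \<and>
     (\<forall>v \<in> carrier_vec (dim_row A). v \<noteq> 0\<^sub>v (dim_row A) \<longrightarrow> v \<bullet> (A *\<^sub>v v) > 0)"


subsection \<open>The two polynomials of a coefficient vector are reversals of each other\<close>

lemma poly_rev_poly:
  assumes "z \<noteq> 0"
  shows "poly (rev_poly a) z = z ^ dim_vec a * poly (hat_poly a) (inverse z)"
proof -
  have "z ^ dim_vec a * (a $ (i - 1) * inverse z ^ (dim_vec a - i)) = a $ (i - 1) * z ^ i"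
    if "i \<in> {1..dim_vec a}" for i
  proof -
    have "z ^ dim_vec a = z ^ i * z ^ (dim_vec a - i)"
      using that by (simp flip: power_add)
    then show ?thesis using assms by (simp add: power_inverse)
  qed
  then have "(\<Sum>i = 1..dim_vec a. z ^ dim_vec a * (a $ (i - 1) * inverse z ^ (dim_vec a - i)))
      = (\<Sum>i = 1..dim_vec a. a $ (i - 1) * z ^ i)"
    by (rule sum.cong[OF refl])
  moreover have "z ^ dim_vec a * inverse z ^ dim_vec a = 1"
    using assms by (simp flip: power_mult_distrib)
  ultimately show ?thesis
    by (simp add: rev_poly_def hat_poly_def poly_sum poly_monom distrib_left sum_distrib_left)
qed

lemma degree_rev_poly: "degree (rev_poly a) \<le> dim_vec a"
  unfolding rev_poly_def
  by (intro degree_add_le degree_sum_le) (auto intro: order.trans[OF degree_monom_le])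


subsection \<open>Existence and uniqueness of the Bezout matrix\<close>

lemma power_vec_bilinear:
  assumes "B \<in> carrier_mat n n"
  shows "power_vec n z \<bullet> (B *\<^sub>v power_vec n w) = (\<Sum>i<n. \<Sum>j<n. B $$ (i, j) * z ^ i * w ^ j)"
  using assms
  by (auto simp: scalar_prod_def power_vec_def sum_distrib_left lessThan_atLeast0 mult_ac
      intro!: sum.cong)

definition bezout_fun :: "nat \<Rightarrow> (real \<Rightarrow> real \<Rightarrow> real) \<Rightarrow> bool" where
  "bezout_fun n f \<longleftrightarrow>
     (\<exists>b. \<forall>z w. f z w = (z - w) * (\<Sum>i<n. \<Sum>j<n. b i j * z ^ i * w ^ j))"

lemma bezout_fun_0: "bezout_fun n (\<lambda>z w. 0)"
  unfolding bezout_fun_def by (rule exI[of _ "\<lambda>i j. 0"]) simp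

lemma bezout_fun_add:
  assumes "bezout_fun n f" "bezout_fun n g"
  shows "bezout_fun n (\<lambda>z w. f z w + g z w)"
proof -
  obtain b b' where
    "\<And>z w. f z w = (z - w) * (\<Sum>i<n. \<Sum>j<n. b i j * z ^ i * w ^ j)"
    "\<And>z w. g z w = (z - w) * (\<Sum>i<n. \<Sum>j<n. b' i j * z ^ i * w ^ j)"
    using assms unfolding bezout_fun_def by blast
  then show ?thesis
    unfolding bezout_fun_def
    by (intro exI[of _ "\<lambda>i j. b i j + b' i j"]) (simp add: distrib_left distrib_right sum.distrib)
qed

lemma bezout_fun_cmult:
  assumes "bezout_fun n f"
  shows "bezout_fun n (\<lambda>z w. x * f z w)"
proof -
  obtain b where "\<And>z w. f z w = (z - w) * (\<Sum>i<n. \<Sum>j<n. b i j * z ^ i * w ^ j)"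
    using assms unfolding bezout_fun_def by blast
  then show ?thesis
    unfolding bezout_fun_def
    by (intro exI[of _ "\<lambda>i j. x * b i j"]) (simp add: sum_distrib_left mult_ac)
qed

lemma bezout_fun_sum:
  assumes "finite S" "\<And>s. s \<in> S \<Longrightarrow> bezout_fun n (f s)"
  shows "bezout_fun n (\<lambda>z w. \<Sum>s\<in>S. f s z w)"
  using assms by (induction S) (auto intro: bezout_fun_0 bezout_fun_add)

lemma bezout_fun_monom:
  assumes "k < n" "l < n"
  shows "bezout_fun n (\<lambda>z w. (z - w) * (z ^ k * w ^ l))"
proof -
  have "(\<Sum>i<n. \<Sum>j<n. (if i = k \<and> j = l then 1 else 0) * z ^ i * w ^ j) = z ^ k * w ^ l"
    for z w :: real
  proof -
    have "(\<Sum>i<n. \<Sum>j<n. (if i = k \<and> j = l then 1 else 0) * z ^ i * w ^ j)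
        = (\<Sum>i<n. \<Sum>j<n. if j = l then (if i = k then z ^ k * w ^ l else 0) else 0)"
      by (intro sum.cong refl) simp
    then show ?thesis using assms by simp
  qed
  then show ?thesis
    unfolding bezout_fun_def by (intro exI[of _ "\<lambda>i j. if i = k \<and> j = l then 1 else 0"]) simp
qed

lemma bezout_fun_diff:
  assumes "k \<le> n" "l \<le> k"
  shows "bezout_fun n (\<lambda>z w. z ^ k * w ^ l - w ^ k * z ^ l)"
proof -
  have "z ^ k * w ^ l - w ^ k * z ^ l
      = (\<Sum>m<k - l. (z - w) * (z ^ (l + m) * w ^ (l + (k - l - Suc m))))" for z w :: real
  proof -
    have "z ^ k * w ^ l - w ^ k * z ^ l = z ^ l * w ^ l * (z ^ (k - l) - w ^ (k - l))"
      using assms(2) by (simp add: algebra_simps flip: power_add)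
    also have "\<dots> = (\<Sum>m<k - l. (z - w) * (z ^ (l + m) * w ^ (l + (k - l - Suc m))))"
      unfolding power_diff_sumr2 sum_distrib_left power_add by (simp only: mult_ac)
    finally show ?thesis .
  qed
  moreover have "bezout_fun n
      (\<lambda>z w. \<Sum>m<k - l. (z - w) * (z ^ (l + m) * w ^ (l + (k - l - Suc m))))"
    using assms by (intro bezout_fun_sum bezout_fun_monom) auto
  ultimately show ?thesis by simp
qed

lemma bezout_fun_diff':
  assumes "k \<le> n" "l \<le> n"
  shows "bezout_fun n (\<lambda>z w. z ^ k * w ^ l - w ^ k * z ^ l)"
proof (cases "l \<le> k")
  case True
  then show ?thesis using bezout_fun_diff assms by blast
next
  case False
  then have "bezout_fun n (\<lambda>z w. (- 1) * (z ^ l * w ^ k - w ^ l * z ^ k))"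
    using assms by (intro bezout_fun_cmult bezout_fun_diff) auto
  then show ?thesis by (simp add: mult_ac)
qed

lemma poly_altdef_le:
  fixes p :: "real poly"
  assumes "degree p \<le> n"
  shows "poly p x = (\<Sum>i\<le>n. coeff p i * x ^ i)"
  unfolding poly_altdef[of p] using assms
  by (intro sum.mono_neutral_left) (auto simp: coeff_eq_0)

lemma ex_bezout_mat:
  assumes "degree p \<le> n" "degree q \<le> n"
  shows "\<exists>B. is_bezout_mat n p q B"
proof -
  have eq: "poly p z * poly q w - poly p w * poly q z =
      (\<Sum>k\<le>n. \<Sum>l\<le>n. coeff p k * coeff q l * (z ^ k * w ^ l - w ^ k * z ^ l))" for z w
    using assms
    by (simp add: poly_altdef_le[of _ n] sum_product sum_subtractf right_diff_distrib mult_ac)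
  have "bezout_fun n (\<lambda>z w. poly p z * poly q w - poly p w * poly q z)"
    unfolding eq by (intro bezout_fun_sum bezout_fun_cmult bezout_fun_diff') auto
  then obtain b where b: "\<And>z w. poly p z * poly q w - poly p w * poly q z
      = (z - w) * (\<Sum>i<n. \<Sum>j<n. b i j * z ^ i * w ^ j)"
    unfolding bezout_fun_def by blast
  have "is_bezout_mat n p q (mat n n (\<lambda>(i, j). b i j))"
    unfolding is_bezout_mat_def by (auto simp: power_vec_bilinear b intro!: sum.cong)
  then show ?thesis ..
qed

lemma coeffs_eq_0_if_vanishing:
  fixes d :: "nat \<Rightarrow> real"
  assumes "\<And>z. z \<noteq> w \<Longrightarrow> (\<Sum>i<n. d i * z ^ i) = 0" and "i < n"
  shows "d i = 0"
proof -
  define p where "p = (\<Sum>i<n. monom (d i) i)"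
  have "UNIV - {w} \<subseteq> {z. poly p z = 0}"
    using assms(1) by (auto simp: p_def poly_sum poly_monom)
  then have "infinite {z. poly p z = 0}"
    using infinite_UNIV_char_0[where 'a = real] finite_subset by fastforce
  then have "p = 0" using poly_roots_finite by blast
  then have "coeff p i = 0" by simp
  then show ?thesis using assms(2) by (simp add: p_def coeff_sum)
qed

lemma bezout_mat_unique:
  assumes "is_bezout_mat n p q B" "is_bezout_mat n p q B'"
  shows "B = B'"
proof -
  have B: "B \<in> carrier_mat n n" and B': "B' \<in> carrier_mat n n"
    using assms by (auto simp: is_bezout_mat_def)
  have *: "(\<Sum>i<n. (\<Sum>j<n. (B $$ (i, j) - B' $$ (i, j)) * w ^ j) * z ^ i) = 0"
    if "z \<noteq> w" for z w
  proof -
    have "(z - w) * (power_vec n z \<bullet> (B *\<^sub>v power_vec n w))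
        = (z - w) * (power_vec n z \<bullet> (B' *\<^sub>v power_vec n w))"
      using assms unfolding is_bezout_mat_def by metis
    then have "(\<Sum>i<n. \<Sum>j<n. B $$ (i, j) * z ^ i * w ^ j)
        = (\<Sum>i<n. \<Sum>j<n. B' $$ (i, j) * z ^ i * w ^ j)"
      using that by (simp add: power_vec_bilinear[OF B] power_vec_bilinear[OF B'])
    then have "(\<Sum>i<n. \<Sum>j<n. (B $$ (i, j) - B' $$ (i, j)) * z ^ i * w ^ j) = 0"
      by (simp add: left_diff_distrib sum_subtractf)
    then show ?thesis by (simp add: sum_distrib_left mult_ac)
  qed
  have "(\<Sum>j<n. (B $$ (i, j) - B' $$ (i, j)) * w ^ j) = 0" if "i < n" for i w
    using * by (rule coeffs_eq_0_if_vanishing[OF _ that])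
  then have "B $$ (i, j) - B' $$ (i, j) = 0" if "i < n" "j < n" for i j
    by (rule coeffs_eq_0_if_vanishing[OF _ that(2)]) (use that(1) in blast)
  then show ?thesis using B B' by (intro eq_matI) simp_all
qed

lemma ex1_bezout_mat:
  assumes "degree p \<le> n" "degree q \<le> n"
  shows "\<exists>!B. is_bezout_mat n p q B"
  using ex_bezout_mat[OF assms] bezout_mat_unique by blast

lemma is_bezout_mat_bezout_mat:
  assumes "a \<in> carrier_vec n" "c \<in> carrier_vec n"
  shows "is_bezout_mat n (rev_poly c) (rev_poly a) (bezout_mat n (rev_poly c) (rev_poly a))"
  unfolding bezout_mat_def
  using theI'[OF ex1_bezout_mat] degree_rev_poly[of a] degree_rev_poly[of c] assms by simp

end

theory Submission
  imports Defs "Jordan_Normal_Form.Spectral_Radius"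
begin

text \<open>
  For a Schur stable \<open>F\<close> the Stein equation has the unique solution $\sum_k v_k v_k^\top$ with
  $v_k = F^k g$; it is positive definite iff the orbit $(v_k)$ spans the space. Both \<open>F_M\<close> and
  \<open>G_N\<close> are block triangular with diagonal blocks similar to companion matrices of the two given
  polynomials or to their transposes, hence stable. The pair \<open>(G_N, e_P)\<close> is a cascade of two
  shift registers, which is reachable whatever the coefficients are. Finally $D = \mathrm{diag}(I, B)$
  fixes \<open>e_P\<close> and intertwines, $F_M D = D G_N$: comparing coefficients in the definition of the
  Bezout matrix \<open>B\<close> yields $B e = c - a$ and $(J - e c^\top)^\top B = B (J - e c^\top)$. So $D Q D$
  solves the equation for \<open>H\<close>.
\<close>

section \<open>Geometrically decaying powers\<close>

text \<open>An entrywise geometric bound instead of an eigenvalue condition: in this form it gives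
  both the decay of the powers and the summability of products of orbit coordinates. The spectrum
  enters only through \<open>stable_matI\<close>.\<close>

definition stable_mat :: "real mat \<Rightarrow> bool" where
  "stable_mat F \<longleftrightarrow> (\<exists>C r. 0 \<le> r \<and> r < 1 \<and>
     (\<forall>k. \<forall>i<dim_row F. \<forall>j<dim_col F. \<bar>(F ^\<^sub>m k) $$ (i, j)\<bar> \<le> C * r ^ k))"

lemma pow_mat_smult:
  fixes A :: "'a :: comm_semiring_1 mat"
  assumes "A \<in> carrier_mat n n"
  shows "(s \<cdot>\<^sub>m A) ^\<^sub>m k = s ^ k \<cdot>\<^sub>m A ^\<^sub>m k"
proof (induction k)
  case 0
  show ?case by auto
next
  case (Suc k)
  have "(s \<cdot>\<^sub>m A) ^\<^sub>m Suc k = (s ^ k \<cdot>\<^sub>m A ^\<^sub>m k) * (s \<cdot>\<^sub>m A)"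
    using Suc by simp
  also have "\<dots> = s \<cdot>\<^sub>m (s ^ k \<cdot>\<^sub>m (A ^\<^sub>m k * A))"
    using assms by (simp add: mult_smult_distrib[of _ n n _ n] mult_smult_assoc_mat[of _ n n _ n])
  finally show ?case by (intro eq_matI) (auto simp: mult_ac)
qed

text \<open>\<open>pow_mat\<close> unfolds with the new factor on the right; orbits need it on the
  left, so that each vector is F applied to its predecessor.\<close>

lemma pow_mat_Suc_left:
  assumes "A \<in> carrier_mat n n"
  shows "A ^\<^sub>m Suc k = A * A ^\<^sub>m k"
proof (induction k)
  case 0
  show ?case using assms by simp
next
  case (Suc k)
  have "A ^\<^sub>m Suc (Suc k) = (A * A ^\<^sub>m k) * A"
    using Suc by simp
  also have "\<dots> = A * (A ^\<^sub>m k * A)"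
    using assms by (intro assoc_mult_mat[of _ n n _ n _ n]) auto
  finally show ?case by simp
qed

lemma spectrum_smult:
  fixes A :: "'a :: field mat"
  assumes "A \<in> carrier_mat n n" "s \<noteq> 0" "k \<in> spectrum (s \<cdot>\<^sub>m A)"
  shows "k / s \<in> spectrum A"
proof -
  obtain v where v: "v \<in> carrier_vec n" "v \<noteq> 0\<^sub>v n" "(s \<cdot>\<^sub>m A) *\<^sub>v v = k \<cdot>\<^sub>v v"
    using assms unfolding spectrum_def eigenvalue_def eigenvector_def by auto
  have "A *\<^sub>v v = (k / s) \<cdot>\<^sub>v v"
  proof
    fix i assume i: "i < dim_vec ((k / s) \<cdot>\<^sub>v v)"
    have "s * (A *\<^sub>v v) $ i = ((s \<cdot>\<^sub>m A) *\<^sub>v v) $ i"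
      using assms(1) v(1) i by simp
    also have "\<dots> = k * v $ i"
      using v i by simp
    finally show "(A *\<^sub>v v) $ i = ((k / s) \<cdot>\<^sub>v v) $ i"
      using assms(2) i by (simp add: field_simps)
  qed (use assms v in auto)
  then show ?thesis
    using v assms(1) unfolding spectrum_def eigenvalue_def eigenvector_def by auto
qed

text \<open>Scaling by the inverse of a number strictly between the spectral radius and 1 still leaves
  a matrix of spectral radius below 1, whose powers are bounded.\<close>

lemma stable_matI:
  assumes F: "F \<in> carrier_mat n n"
    and ev: "\<And>k. k \<in> spectrum (map_mat complex_of_real F) \<Longrightarrow> norm k < 1"
  shows "stable_mat F"
proof (cases "n = 0")
  \<comment> \<open>The spectral radius is a maximum over the spectrum, which is empty in dimension
    0; there the entrywise bound is vacuous.\<close>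
  case True
  then show ?thesis
    using F unfolding stable_mat_def by (intro exI[of _ 0]) auto
next
  case False
  let ?A = "map_mat complex_of_real F"
  have A: "?A \<in> carrier_mat n n"
    using F by simp
  have "0 \<le> spectral_radius ?A" "spectral_radius ?A < 1"
    using spectral_radius_mem_max(1)[OF A] False ev by auto
  then obtain r where r: "spectral_radius ?A < r" "r < 1" "0 < r"
    using dense[of "spectral_radius ?A" 1] by fastforce
  define s where "s = complex_of_real (1 / r)"
  have s: "s \<noteq> 0"
    using r by (simp add: s_def)
  have sA: "s \<cdot>\<^sub>m ?A \<in> carrier_mat n n"
    using A by simp
  have "norm k < 1" if "k \<in> spectrum (s \<cdot>\<^sub>m ?A)" for k
  proof -
    have "norm (k / s) \<le> spectral_radius ?A"
      using spectral_radius_mem_max(2)[OF A _ imageI] spectrum_smult[OF A s that] False by simp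
    then have "norm k * r \<le> spectral_radius ?A"
      using r by (simp add: s_def norm_divide norm_mult)
    then have "norm k * r < 1 * r"
      using r by linarith
    then show ?thesis
      using r mult_less_cancel_right_pos by blast
  qed
  then have "spectral_radius (s \<cdot>\<^sub>m ?A) < 1"
    using spectral_radius_mem_max(1)[OF sA] False by auto
  then obtain C where C: "\<And>k. norm_bound ((s \<cdot>\<^sub>m ?A) ^\<^sub>m k) C"
    using spectral_radius_jnf_norm_bound_less_1_upper_triangular[OF sA] by blast
  \<comment> \<open>Since s = 1/r, undoing the scaling turns the uniform bound C on the scaled
    powers into C * r^k.\<close>
  have "\<bar>(F ^\<^sub>m k) $$ (i, j)\<bar> \<le> C * r ^ k" if ij: "i < n" "j < n" for k i j
  proof -
    have "((s \<cdot>\<^sub>m ?A) ^\<^sub>m k) $$ (i, j) = s ^ k * of_real ((F ^\<^sub>m k) $$ (i, j))"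
      using ij F unfolding pow_mat_smult[OF A] of_real_hom.mat_hom_pow[OF F, symmetric] by simp
    moreover have "norm (((s \<cdot>\<^sub>m ?A) ^\<^sub>m k) $$ (i, j)) \<le> C"
      using C[of k] ij F unfolding norm_bound_def by simp
    ultimately have "\<bar>(F ^\<^sub>m k) $$ (i, j)\<bar> / r ^ k \<le> C"
      using r by (simp add: s_def norm_mult norm_divide norm_power power_divide)
    then show ?thesis
      using r by (simp add: field_simps)
  qed
  then show ?thesis
    using F r unfolding stable_mat_def by (intro exI[of _ C] exI[of _ r]) auto
qed

lemma stable_mat_tendsto_0:
  assumes "stable_mat F" "i < dim_row F" "j < dim_col F"
  shows "(\<lambda>k. (F ^\<^sub>m k) $$ (i, j)) \<longlonglongrightarrow> 0"
proof -
  obtain C r where r: "0 \<le> r" "r < 1" and le: "\<And>k. \<bar>(F ^\<^sub>m k) $$ (i, j)\<bar> \<le> C * r ^ k"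
    using assms unfolding stable_mat_def by blast
  have "(\<lambda>k. C * r ^ k) \<longlonglongrightarrow> 0"
    using r by (intro tendsto_mult_right_zero LIMSEQ_power_zero) auto
  then show ?thesis
    by (rule tendsto_0_le[where K = 1])
      (use le in \<open>auto intro!: always_eventually order.trans[OF _ abs_ge_self]\<close>)
qed

text \<open>Each orbit coordinate is O(r^k), so the products are dominated by a geometric series of
  ratio r^2 < 1.\<close>

lemma stable_mat_summable_orbit:
  assumes F: "stable_mat F" "F \<in> carrier_mat n n" and g: "g \<in> carrier_vec n"
    and ij: "i < n" "j < n"
  shows "summable (\<lambda>k. (F ^\<^sub>m k *\<^sub>v g) $ i * (F ^\<^sub>m k *\<^sub>v g) $ j)"
proof -
  obtain C r where r: "0 \<le> r" "r < 1"
    and le: "\<And>k i j. i < n \<Longrightarrow> j < n \<Longrightarrow> \<bar>(F ^\<^sub>m k) $$ (i, j)\<bar> \<le> C * r ^ k"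
    using F(1) unfolding stable_mat_def carrier_matD[OF F(2)] by blast
  \<comment> \<open>M is C times the l1 norm of g, which bounds a row of F^k applied to g up to the
    factor r^k.\<close>
  define M where "M = (\<Sum>q<n. C * \<bar>g $ q\<bar>)"
  have bound: "\<bar>(F ^\<^sub>m k *\<^sub>v g) $ i\<bar> \<le> M * r ^ k" if "i < n" for i k
  proof -
    have "(F ^\<^sub>m k *\<^sub>v g) $ i = (\<Sum>q<n. (F ^\<^sub>m k) $$ (i, q) * g $ q)"
      using F g that by (simp add: scalar_prod_def lessThan_atLeast0)
    also have "\<bar>\<dots>\<bar> \<le> (\<Sum>q<n. \<bar>(F ^\<^sub>m k) $$ (i, q)\<bar> * \<bar>g $ q\<bar>)"
      by (simp add: sum_abs flip: abs_mult)
    also have "\<dots> \<le> (\<Sum>q<n. C * r ^ k * \<bar>g $ q\<bar>)"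
      using le that by (intro sum_mono mult_right_mono) auto
    finally show ?thesis
      by (simp add: M_def sum_distrib_left mult_ac)
  qed
  have "norm ((F ^\<^sub>m k *\<^sub>v g) $ i * (F ^\<^sub>m k *\<^sub>v g) $ j) \<le> M\<^sup>2 * (r\<^sup>2) ^ k" for k
  proof -
    \<comment> \<open>C comes without a sign, so the nonnegativity of M * r^k is read off from
      \<open>bound\<close>, where it dominates an absolute value.\<close>
    have "norm ((F ^\<^sub>m k *\<^sub>v g) $ i * (F ^\<^sub>m k *\<^sub>v g) $ j) \<le> (M * r ^ k) * (M * r ^ k)"
      unfolding real_norm_def abs_mult using bound ij
      by (intro mult_mono) (auto intro: order.trans[OF abs_ge_zero])
    then show ?thesis
      by (simp add: power2_eq_square power_mult_distrib mult_ac)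
  qed
  moreover have "summable (\<lambda>k. M\<^sup>2 * (r\<^sup>2) ^ k)"
    using r by (intro summable_mult summable_geometric) (simp add: power_less_one_iff abs_square_less_1)
  ultimately show ?thesis
    by (rule summable_comparison_test'[rotated, where N = 0])
qed

section \<open>Stein equations\<close>

lemma mult_mult_transpose_index:
  fixes F X :: "real mat"
  assumes "F \<in> carrier_mat n n" "X \<in> carrier_mat n n" "i < n" "j < n"
  shows "(F * X * transpose_mat F) $$ (i, j) = (\<Sum>p<n. \<Sum>q<n. F $$ (i, p) * X $$ (p, q) * F $$ (j, q))"
  using assms by (simp add: scalar_prod_def lessThan_atLeast0 sum_distrib_left mult.assoc)

lemma mult_mat_vec_index:
  fixes F :: "real mat"
  assumes "F \<in> carrier_mat m n" "v \<in> carrier_vec n" "i < m"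
  shows "(F *\<^sub>v v) $ i = (\<Sum>p<n. F $$ (i, p) * v $ p)"
  using assms by (simp add: scalar_prod_def lessThan_atLeast0)

lemma outer_carrier [simp]: "u \<in> carrier_vec m \<Longrightarrow> v \<in> carrier_vec n \<Longrightarrow> outer u v \<in> carrier_mat m n"
  by (auto simp: outer_def)

lemma outer_dim [simp]: "dim_row (outer u v) = dim_vec u" "dim_col (outer u v) = dim_vec v"
  by (auto simp: outer_def)

lemma outer_index [simp]: "i < dim_vec u \<Longrightarrow> j < dim_vec v \<Longrightarrow> outer u v $$ (i, j) = u $ i * v $ j"
  by (simp add: outer_def)

text \<open>The input term cancels in the difference E of two solutions, so E = F E F^T. Iteration
  gives E = F^k E (F^k)^T for all k, and the right side tends to 0.\<close>

lemma stein_solution_unique: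
  assumes F: "stable_mat F" "F \<in> carrier_mat n n" and g: "g \<in> carrier_vec n"
    and X: "stein_solution F g X" and Y: "stein_solution F g Y"
  shows "X = Y"
proof -
  define E where "E = X - Y"
  have XY: "X \<in> carrier_mat n n" "Y \<in> carrier_mat n n"
    and X_eq: "X = F * X * transpose_mat F + outer g g"
    and Y_eq: "Y = F * Y * transpose_mat F + outer g g"
    using X Y g unfolding stein_solution_def by auto
  have E: "E \<in> carrier_mat n n"
    using XY by (auto simp: E_def)
  have E_eq: "E = F * E * transpose_mat F"
  proof
    fix i j assume "i < dim_row (F * E * transpose_mat F)" "j < dim_col (F * E * transpose_mat F)"
    then have ij: "i < n" "j < n" using F by auto
    have "E $$ (i, j) = X $$ (i, j) - Y $$ (i, j)"
      using ij XY by (simp add: E_def)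
    also have "\<dots> = (F * X * transpose_mat F) $$ (i, j) - (F * Y * transpose_mat F) $$ (i, j)"
      by (subst X_eq, subst Y_eq) (use ij XY g F in simp)
    also have "\<dots> = (F * E * transpose_mat F) $$ (i, j)"
      using ij XY unfolding mult_mult_transpose_index[OF F(2) XY(1) ij]
        mult_mult_transpose_index[OF F(2) XY(2) ij] mult_mult_transpose_index[OF F(2) E ij]
      by (simp add: E_def algebra_simps flip: sum_subtractf)
    finally show "E $$ (i, j) = (F * E * transpose_mat F) $$ (i, j)" .
  qed (use E F in auto)
  have pow: "E = F ^\<^sub>m k * E * transpose_mat (F ^\<^sub>m k)" for k
  proof (induction k)
    case 0
    show ?case using E F by simp
  next
    case (Suc k)
    let ?P = "F ^\<^sub>m k"
    have P: "?P \<in> carrier_mat n n" using F by simp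
    \<comment> \<open>The inner E is the one replaced by F E F^T, so that the new factors land next
      to F^k.\<close>
    have "E = ?P * (F * E * transpose_mat F) * transpose_mat ?P"
      using Suc E_eq by simp
    also have "\<dots> = (?P * F) * E * (transpose_mat F * transpose_mat ?P)"
      using F E P by (simp add: assoc_mult_mat[of _ n n _ n _ n])
    also have "transpose_mat F * transpose_mat ?P = transpose_mat (?P * F)"
      using F P by (simp add: transpose_mult[of _ n n _ n])
    finally show ?case by simp
  qed
  have "E $$ (i, j) = 0" if ij: "i < n" "j < n" for i j
  proof -
    have "(\<lambda>k. \<Sum>p<n. \<Sum>q<n. (F ^\<^sub>m k) $$ (i, p) * E $$ (p, q) * (F ^\<^sub>m k) $$ (j, q)) \<longlonglongrightarrow>
        (\<Sum>p<n. \<Sum>q<n. 0 * E $$ (p, q) * 0)"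
      using F ij by (intro tendsto_intros stable_mat_tendsto_0) auto
    moreover have "(\<Sum>p<n. \<Sum>q<n. (F ^\<^sub>m k) $$ (i, p) * E $$ (p, q) * (F ^\<^sub>m k) $$ (j, q)) = E $$ (i, j)"
      for k
      using arg_cong[OF pow[of k], of "\<lambda>M. M $$ (i, j)"]
        mult_mult_transpose_index[OF pow_carrier_mat[OF F(2)] E ij] by simp
    ultimately show ?thesis
      by (simp add: LIMSEQ_const_iff)
  qed
  then show ?thesis
    using XY by (intro eq_matI) (auto simp: E_def)
qed

section \<open>Existence and definiteness of the solution\<close>

text \<open>The infinite-horizon reachability Gramian of the pair (F, g). Being an entrywise
  \<open>suminf\<close>, it is meaningful once the series converge, as \<open>gramian_sums\<close>
  ensures for stable F.\<close>

definition gramian :: "real mat \<Rightarrow> real vec \<Rightarrow> real mat" where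
  "gramian F g = mat (dim_vec g) (dim_vec g)
     (\<lambda>(i, j). \<Sum>k. (F ^\<^sub>m k *\<^sub>v g) $ i * (F ^\<^sub>m k *\<^sub>v g) $ j)"

lemma gramian_carrier: "g \<in> carrier_vec n \<Longrightarrow> gramian F g \<in> carrier_mat n n"
  by (simp add: gramian_def)

lemma gramian_sums:
  assumes "stable_mat F" "F \<in> carrier_mat n n" "g \<in> carrier_vec n" "i < n" "j < n"
  shows "(\<lambda>k. (F ^\<^sub>m k *\<^sub>v g) $ i * (F ^\<^sub>m k *\<^sub>v g) $ j) sums gramian F g $$ (i, j)"
  using stable_mat_summable_orbit[OF assms] assms by (simp add: gramian_def summable_sums)

text \<open>Applying F on the left and F^T on the right moves the term of index k to index k + 1;
  the term of index 0 that is then missing is \<open>outer g g\<close>.\<close>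

lemma stein_solution_gramian:
  assumes F: "stable_mat F" "F \<in> carrier_mat n n" and g: "g \<in> carrier_vec n"
  shows "stein_solution F g (gramian F g)"
proof -
  let ?X = "gramian F g"
  define v where "v k = F ^\<^sub>m k *\<^sub>v g" for k
  have X: "?X \<in> carrier_mat n n"
    using g by (rule gramian_carrier)
  have v: "v k \<in> carrier_vec n" for k
    unfolding v_def using pow_carrier_mat[OF F(2)] g by (rule mult_mat_vec_carrier)
  have v_Suc: "v (Suc k) $ i = (\<Sum>p<n. F $$ (i, p) * v k $ p)" if "i < n" for k i
  proof -
    have "v (Suc k) = F *\<^sub>v v k"
      unfolding v_def pow_mat_Suc_left[OF F(2)] using F g by (simp add: assoc_mult_mat_vec[of _ n n _ n])
    then show ?thesis
      using mult_mat_vec_index[OF F(2) v that] by simp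
  qed
  have "?X = F * ?X * transpose_mat F + outer g g"
  proof
    fix i j assume "i < dim_row (F * ?X * transpose_mat F + outer g g)"
      "j < dim_col (F * ?X * transpose_mat F + outer g g)"
    then have ij: "i < n" "j < n" using g by auto
    have "(\<lambda>k. \<Sum>p<n. \<Sum>q<n. F $$ (i, p) * (v k $ p * v k $ q) * F $$ (j, q)) sums
        (\<Sum>p<n. \<Sum>q<n. F $$ (i, p) * ?X $$ (p, q) * F $$ (j, q))"
      unfolding v_def by (intro sums_sum sums_mult sums_mult2 gramian_sums[OF F g]) auto
    moreover have "(\<Sum>p<n. \<Sum>q<n. F $$ (i, p) * (v k $ p * v k $ q) * F $$ (j, q)) =
        v (Suc k) $ i * v (Suc k) $ j" for k
      unfolding v_Suc[OF ij(1)] v_Suc[OF ij(2)] sum_product by (simp add: mult_ac)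
    ultimately have "(\<lambda>k. v (Suc k) $ i * v (Suc k) $ j) sums ((F * ?X * transpose_mat F) $$ (i, j))"
      unfolding mult_mult_transpose_index[OF F(2) X ij] by simp
    then have "(\<lambda>k. v k $ i * v k $ j) sums ((F * ?X * transpose_mat F) $$ (i, j) + v 0 $ i * v 0 $ j)"
      by (rule sums_Suc)
    moreover have "v 0 = g"
      using F g by (simp add: v_def)
    ultimately show "?X $$ (i, j) = (F * ?X * transpose_mat F + outer g g) $$ (i, j)"
      using gramian_sums[OF F g ij] ij g F X unfolding v_def[symmetric]
      by (auto dest: sums_unique2)
  qed (use X F g in auto)
  then show ?thesis
    using X g unfolding stein_solution_def by auto
qed

lemma ex1_stein_solution:
  assumes "stable_mat F" "F \<in> carrier_mat n n" "g \<in> carrier_vec n"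
  shows "\<exists>!X. stein_solution F g X"
  using stein_solution_gramian[OF assms] stein_solution_unique[OF assms] by blast

lemma stein_solution_the_eq:
  assumes "stable_mat F" "F \<in> carrier_mat n n" "g \<in> carrier_vec n" "stein_solution F g X"
  shows "(THE X. stein_solution F g X) = X"
  using ex1_stein_solution[OF assms(1-3)] assms(4) by (rule the1_equality)

text \<open>The quadratic form at w is the sum of the squares of the products of w with the orbit
  vectors. By \<open>reach\<close>, a nonzero w makes at least one of them positive.\<close>

lemma pos_definite_gramian:
  assumes F: "stable_mat F" "F \<in> carrier_mat n n" and g: "g \<in> carrier_vec n"
    and reach: "\<And>w. w \<in> carrier_vec n \<Longrightarrow> (\<And>k. w \<bullet> (F ^\<^sub>m k *\<^sub>v g) = 0) \<Longrightarrow> w = 0\<^sub>v n"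
  shows "pos_definite (gramian F g)"
proof -
  let ?X = "gramian F g"
  have X: "?X \<in> carrier_mat n n"
    using g by (rule gramian_carrier)
  have "transpose_mat ?X = ?X"
    by (intro eq_matI) (auto simp: gramian_def mult.commute)
  moreover have "w \<bullet> (?X *\<^sub>v w) > 0" if w: "w \<in> carrier_vec n" "w \<noteq> 0\<^sub>v n" for w
  proof -
    define f where "f k = (w \<bullet> (F ^\<^sub>m k *\<^sub>v g))\<^sup>2" for k
    have "(\<lambda>k. \<Sum>i<n. w $ i * (\<Sum>j<n. ((F ^\<^sub>m k *\<^sub>v g) $ i * (F ^\<^sub>m k *\<^sub>v g) $ j) * w $ j)) sums
        (\<Sum>i<n. w $ i * (\<Sum>j<n. ?X $$ (i, j) * w $ j))"
      by (intro sums_sum sums_mult sums_mult2 gramian_sums[OF F g]) auto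
    moreover have "(\<Sum>i<n. w $ i * (\<Sum>j<n. ?X $$ (i, j) * w $ j)) = w \<bullet> (?X *\<^sub>v w)"
      using X w by (simp add: scalar_prod_def lessThan_atLeast0)
    moreover have "(\<Sum>i<n. w $ i * (\<Sum>j<n. ((F ^\<^sub>m k *\<^sub>v g) $ i * (F ^\<^sub>m k *\<^sub>v g) $ j) * w $ j)) = f k" for k
    proof -
      have "w \<bullet> (F ^\<^sub>m k *\<^sub>v g) = (\<Sum>i<n. w $ i * (F ^\<^sub>m k *\<^sub>v g) $ i)"
        using F g w by (simp add: scalar_prod_def lessThan_atLeast0)
      then show ?thesis
        unfolding f_def power2_eq_square by (simp add: sum_product sum_distrib_left mult_ac)
    qed
    ultimately have sums: "f sums (w \<bullet> (?X *\<^sub>v w))"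
      by simp
    obtain k where "w \<bullet> (F ^\<^sub>m k *\<^sub>v g) \<noteq> 0"
      using reach w by blast
    then have "0 < f k"
      by (simp add: f_def)
    then have "0 < suminf f"
      using sums by (intro suminf_pos2[of _ k]) (auto simp: f_def sums_iff)
    then show ?thesis
      using sums by (simp add: sums_iff)
  qed
  ultimately show ?thesis
    using X unfolding pos_definite_def by auto
qed

section \<open>The companion matrix\<close>

lemma shift_mat_carrier [simp]: "shift_mat n \<in> carrier_mat n n"
  by (simp add: shift_mat_def)

lemma antidiag_mat_carrier [simp]: "antidiag_mat n \<in> carrier_mat n n"
  by (simp add: antidiag_mat_def)

lemma shift_mat_dim [simp]: "dim_row (shift_mat n) = n" "dim_col (shift_mat n) = n"
  by (simp_all add: shift_mat_def)

lemma antidiag_mat_dim [simp]: "dim_row (antidiag_mat n) = n" "dim_col (antidiag_mat n) = n"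
  by (simp_all add: antidiag_mat_def)

lemma antidiag_mat_vec_index:
  assumes "v \<in> carrier_vec n" "i < n"
  shows "(antidiag_mat n *\<^sub>v v) $ i = v $ (n - 1 - i)"
proof -
  have "(antidiag_mat n *\<^sub>v v) $ i = (\<Sum>p<n. if p = n - 1 - i then v $ p else 0)"
    unfolding mult_mat_vec_index[OF antidiag_mat_carrier assms] using assms(2)
    by (intro sum.cong) (auto simp: antidiag_mat_def)
  then show ?thesis using assms(2) by simp
qed

lemma antidiag_mult_index:
  assumes "X \<in> carrier_mat n m" "i < n" "j < m"
  shows "(antidiag_mat n * X) $$ (i, j) = X $$ (n - 1 - i, j)"
proof -
  have "(antidiag_mat n * X) $$ (i, j) = (antidiag_mat n *\<^sub>v col X j) $ i"
    using assms by simp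
  then show ?thesis
    using antidiag_mat_vec_index[of "col X j" n i] assms by simp
qed

lemma transpose_antidiag_mat: "transpose_mat (antidiag_mat n) = antidiag_mat n"
  by (intro eq_matI) (auto simp: antidiag_mat_def add.commute)

lemma mult_antidiag_index:
  assumes X: "X \<in> carrier_mat m n" and ij: "i < m" "j < n"
  shows "(X * antidiag_mat n) $$ (i, j) = X $$ (i, n - 1 - j)"
proof -
  have "(X * antidiag_mat n) $$ (i, j) = (antidiag_mat n * transpose_mat X) $$ (j, i)"
    using arg_cong[OF transpose_mult[OF X antidiag_mat_carrier], of "\<lambda>M. M $$ (j, i)"] X ij
    by (simp add: transpose_antidiag_mat)
  then show ?thesis
    using antidiag_mult_index[of "transpose_mat X" n m j i] X ij by simp
qed

lemma antidiag_conj_index: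
  assumes "X \<in> carrier_mat n n" "i < n" "j < n"
  shows "(antidiag_mat n * X * antidiag_mat n) $$ (i, j) = X $$ (n - 1 - i, n - 1 - j)"
  using assms mult_antidiag_index[of "antidiag_mat n * X" n n i j]
    antidiag_mult_index[of X n n i "n - 1 - j"] mult_carrier_mat[OF antidiag_mat_carrier, of X n n]
  by (simp del: index_mult_mat(1))

lemma antidiag_mat_square: "antidiag_mat n * antidiag_mat n = 1\<^sub>m n"
proof
  fix i j assume "i < dim_row (1\<^sub>m n)" "j < dim_col (1\<^sub>m n)"
  then have ij: "i < n" "j < n" by auto
  show "(antidiag_mat n * antidiag_mat n) $$ (i, j) = 1\<^sub>m n $$ (i, j)"
    unfolding antidiag_mult_index[OF antidiag_mat_carrier ij] using ij
    by (auto simp: antidiag_mat_def)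
qed auto

text \<open>Conjugation by P reverses the order of the basis and so turns the subdiagonal into the
  superdiagonal.\<close>

lemma antidiag_conj_shift_mat:
  "antidiag_mat n * shift_mat n * antidiag_mat n = transpose_mat (shift_mat n)"
proof
  fix i j assume "i < dim_row (transpose_mat (shift_mat n))" "j < dim_col (transpose_mat (shift_mat n))"
  then have ij: "i < n" "j < n" by auto
  show "(antidiag_mat n * shift_mat n * antidiag_mat n) $$ (i, j) = transpose_mat (shift_mat n) $$ (i, j)"
    unfolding antidiag_conj_index[OF shift_mat_carrier ij] using ij by (auto simp: shift_mat_def)
qed auto

text \<open>The companion matrix of \<open>hat_poly a\<close> in top-row form: negated coefficients
  in row 0, ones below the diagonal.\<close>

definition companion :: "nat \<Rightarrow> real vec \<Rightarrow> real mat" where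
  "companion n a = shift_mat n - outer (unit_vec n 0) a"

lemma companion_carrier [simp]: "a \<in> carrier_vec n \<Longrightarrow> companion n a \<in> carrier_mat n n"
  by (intro carrier_matI) (auto simp: companion_def)

lemma companion_dim [simp]:
  "dim_row (companion n a) = n" "dim_col (companion n a) = dim_vec a"
  by (simp_all add: companion_def)

lemma companion_index:
  assumes "a \<in> carrier_vec n" "i < n" "j < n"
  shows "companion n a $$ (i, j) = (if i = j + 1 then 1 else 0) - (if i = 0 then a $ j else 0)"
  using assms by (simp add: companion_def shift_mat_def)

text \<open>An eigenvector of the companion matrix for \<open>k\<close> is a multiple of $(k^{n-1},\dots,k,1)$, and
  the first row of the eigenvalue equation then says that \<open>k\<close> is a root.\<close>

lemma spectrum_companion:
  assumes a: "a \<in> carrier_vec n" and k: "k \<in> spectrum (map_mat complex_of_real (companion n a))"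
  shows "poly (map_poly of_real (hat_poly a)) k = 0"
proof -
  let ?A = "map_mat complex_of_real (companion n a)"
  have A: "?A \<in> carrier_mat n n"
    using a by simp
  obtain v where v: "v \<in> carrier_vec n" "v \<noteq> 0\<^sub>v n" and eig: "?A *\<^sub>v v = k \<cdot>\<^sub>v v"
    using k A unfolding spectrum_def eigenvalue_def eigenvector_def by auto
  have row: "(\<Sum>j<n. of_real (companion n a $$ (i, j)) * v $ j) = k * v $ i" if "i < n" for i
    using arg_cong[OF eig, of "\<lambda>x. x $ i"] that v a
    by (simp add: scalar_prod_def lessThan_atLeast0)
  \<comment> \<open>Below row 0 the companion matrix is the pure shift, so row i + 1 of the
    eigenvalue equation links neighbouring entries of v.\<close>
  have step: "v $ i = k * v $ Suc i" if "Suc i < n" for i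
  proof -
    have "(\<Sum>j<n. of_real (companion n a $$ (Suc i, j)) * v $ j) = (\<Sum>j<n. if j = i then v $ j else 0)"
      using a that by (intro sum.cong) (auto simp: companion_index)
    then show ?thesis
      using row[OF that] that by simp
  qed
  have pow: "v $ (n - 1 - m) = k ^ m * v $ (n - 1)" if "m < n" for m
    using that
  proof (induction m)
    case (Suc m)
    then have "Suc (n - 1 - Suc m) = n - 1 - m"
      by auto
    then show ?case
      using Suc step[of "n - 1 - Suc m"] by simp
  qed simp
  have pow': "v $ j = k ^ (n - Suc j) * v $ (n - 1)" if "j < n" for j
    using pow[of "n - 1 - j"] that by simp
  have n: "0 < n"
    using v by (cases n) auto
  \<comment> \<open>Every entry is a multiple of the last one, so the last one can be cancelled from
    row 0 of the equation.\<close>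
  have last: "v $ (n - 1) \<noteq> 0"
  proof
    assume "v $ (n - 1) = 0"
    then have "v = 0\<^sub>v n"
      using v pow' by (intro eq_vecI) auto
    then show False using v by simp
  qed
  have "k ^ n * v $ (n - 1) = k * v $ 0"
    unfolding pow'[OF n] using n by (simp flip: power_Suc)
  also have "\<dots> = (\<Sum>j<n. - (of_real (a $ j) * k ^ (n - Suc j)) * v $ (n - 1))"
    unfolding row[OF n, symmetric]
  proof (intro sum.cong refl)
    fix j assume "j \<in> {..<n}"
    then have j: "j < n" by simp
    show "of_real (companion n a $$ (0, j)) * v $ j = - (of_real (a $ j) * k ^ (n - Suc j)) * v $ (n - 1)"
      unfolding pow'[OF j] using companion_index[OF a n j] by simp
  qed
  finally have "(k ^ n + (\<Sum>j<n. of_real (a $ j) * k ^ (n - Suc j))) * v $ (n - 1) = 0"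
    by (simp add: distrib_right sum_distrib_right sum_negf)
  then have "k ^ n + (\<Sum>j<n. of_real (a $ j) * k ^ (n - Suc j)) = 0"
    using last by simp
  moreover have "map_poly complex_of_real (hat_poly a)
      = monom 1 n + (\<Sum>i = 1..n. monom (of_real (a $ (i - 1))) (n - i))"
    using a by (intro poly_eqI) (auto simp: hat_poly_def coeff_sum coeff_map_poly intro!: sum.cong)
  then have "poly (map_poly of_real (hat_poly a)) k
      = k ^ n + (\<Sum>i = 1..n. of_real (a $ (i - 1)) * k ^ (n - i))"
    by (simp add: poly_sum poly_monom)
  \<comment> \<open>The coefficient a_i is stored at index i - 1, so the two sums differ by j = i -
    1.\<close>
  moreover have "(\<Sum>i = 1..n. of_real (a $ (i - 1)) * k ^ (n - i)) = (\<Sum>j<n. of_real (a $ j) * k ^ (n - Suc j))"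
    by (rule sum.reindex_bij_witness[of _ Suc "\<lambda>i. i - 1"]) auto
  ultimately show ?thesis by simp
qed

section \<open>Stability of \<open>F_M\<close> and \<open>G_N\<close>\<close>

text \<open>The characteristic polynomial of a block triangular matrix is the product of those of
  its diagonal blocks, so every eigenvalue belongs to one of them.\<close>

lemma stable_mat_lower_block:
  assumes BD: "B \<in> carrier_mat n n" "C \<in> carrier_mat m n" "D \<in> carrier_mat m m"
    and B: "\<And>k. k \<in> spectrum (map_mat complex_of_real B) \<Longrightarrow> norm k < 1"
    and D: "\<And>k. k \<in> spectrum (map_mat complex_of_real D) \<Longrightarrow> norm k < 1"
  shows "stable_mat (four_block_mat B (0\<^sub>m n m) C D)"
proof (rule stable_matI)
  let ?c = "map_mat complex_of_real"
  let ?A = "four_block_mat B (0\<^sub>m n m) C D"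
  show A: "?A \<in> carrier_mat (n + m) (n + m)"
    using BD by simp
  have "?c ?A = four_block_mat (?c B) (?c (0\<^sub>m n m)) (?c C) (?c D)"
    using BD by (intro map_four_block_mat) auto
  also have "?c (0\<^sub>m n m) = 0\<^sub>m n m"
    by (intro eq_matI) auto
  finally have "char_poly (?c ?A) = char_poly (?c B) * char_poly (?c D)"
    using BD char_poly_factorized[of "?c B" n] char_poly_factorized[of "?c D" m]
    by (intro char_poly_0_block'[of _ _ n m "?c C"]) auto
  then show "norm k < 1" if "k \<in> spectrum (?c ?A)" for k
    using that B D BD A spectrum_root_char_poly[of "?c B" n] spectrum_root_char_poly[of "?c D" m]
      spectrum_root_char_poly[of "?c ?A" "n + m"] by auto
qed

lemma spectrum_transpose:
  fixes A :: "'a :: field mat"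
  assumes "A \<in> carrier_mat n n"
  shows "spectrum (transpose_mat A) = spectrum A"
  using spectrum_root_char_poly[of A n] spectrum_root_char_poly[of "transpose_mat A" n]
    char_poly_transpose_mat assms by simp

text \<open>P is its own inverse, so conjugation by P is a similarity.\<close>

lemma spectrum_antidiag_conj:
  assumes X: "X \<in> carrier_mat n n"
  shows "spectrum (map_mat complex_of_real (antidiag_mat n * X * antidiag_mat n)) =
    spectrum (map_mat complex_of_real X)"
proof -
  let ?c = "map_mat complex_of_real"
  let ?P = "antidiag_mat n"
  have "similar_mat (?c (?P * X * ?P)) (?c X)"
  proof (rule similar_matI[of _ _ "?c ?P" "?c ?P" n])
    show "?c ?P * ?c ?P = 1\<^sub>m n" "?c ?P * ?c ?P = 1\<^sub>m n"
      using of_real_hom.mat_hom_mult[of ?P n n ?P n, where 'a = complex]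
      by (simp_all add: antidiag_mat_square of_real_hom.mat_hom_one)
    show "?c (?P * X * ?P) = ?c ?P * ?c X * ?c ?P"
      using of_real_hom.mat_hom_mult[of "?P * X" n n ?P n, where 'a = complex]
        of_real_hom.mat_hom_mult[of ?P n n X n, where 'a = complex]
        X mult_carrier_mat[OF antidiag_mat_carrier X] by simp
  qed (use X in auto)
  then have "char_poly (?c (?P * X * ?P)) = char_poly (?c X)"
    by (rule char_poly_similar)
  then show ?thesis
    using X spectrum_root_char_poly[of "?c (?P * X * ?P)" n] spectrum_root_char_poly[of "?c X" n]
      mult_carrier_mat[OF mult_carrier_mat[OF antidiag_mat_carrier X] antidiag_mat_carrier] by simp
qed

text \<open>Since P J P = J^T, the lower right block is (J - e c^T)^T. This form gives its spectrum
  and matches the intertwining relation of the Bezout matrix.\<close>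

lemma F_M_eq:
  "F_M n a c = four_block_mat (antidiag_mat n * companion n a * antidiag_mat n) (0\<^sub>m n n)
     (outer (c - a) (unit_vec n 0)) (transpose_mat (companion n c))"
  if "a \<in> carrier_vec n" "c \<in> carrier_vec n"
proof -
  have "transpose_mat (shift_mat n) - outer c (unit_vec n 0) = transpose_mat (companion n c)"
    using that by (intro eq_matI) (auto simp: companion_def)
  then show ?thesis
    by (simp add: F_M_def Let_def antidiag_conj_shift_mat companion_def)
qed

lemma G_N_eq:
  "G_N n a c = four_block_mat (antidiag_mat n * companion n a * antidiag_mat n) (0\<^sub>m n n)
     (outer (unit_vec n 0) (unit_vec n 0)) (companion n c)"
  by (simp add: G_N_def Let_def companion_def)

lemma F_M_carrier: "a \<in> carrier_vec n \<Longrightarrow> c \<in> carrier_vec n \<Longrightarrow> F_M n a c \<in> carrier_mat (n + n) (n + n)"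
  by (intro carrier_matI) (auto simp: F_M_eq)

lemma G_N_carrier: "a \<in> carrier_vec n \<Longrightarrow> c \<in> carrier_vec n \<Longrightarrow> G_N n a c \<in> carrier_mat (n + n) (n + n)"
  by (intro carrier_matI) (auto simp: G_N_eq)

lemma e_P_carrier: "e_P n \<in> carrier_vec (n + n)"
  unfolding e_P_def by (intro append_carrier_vec mult_mat_vec_carrier[of _ n n]) auto

lemma spectrum_companion_norm_less_1:
  assumes "a \<in> carrier_vec n" "zeros_in_unit_disc (hat_poly a)"
    "k \<in> spectrum (map_mat complex_of_real (companion n a))"
  shows "norm k < 1"
  using spectrum_companion[OF assms(1,3)] assms(2) unfolding zeros_in_unit_disc_def by blast

lemma stable_F_M:
  assumes a: "a \<in> carrier_vec n" "zeros_in_unit_disc (hat_poly a)"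
    and c: "c \<in> carrier_vec n" "zeros_in_unit_disc (hat_poly c)"
  shows "stable_mat (F_M n a c)"
  unfolding F_M_eq[OF a(1) c(1)]
proof (rule stable_mat_lower_block)
  show "norm k < 1" if "k \<in> spectrum (map_mat complex_of_real (transpose_mat (companion n c)))" for k
    using that c spectrum_transpose[of "map_mat complex_of_real (companion n c)" n]
    by (intro spectrum_companion_norm_less_1[OF c]) (simp add: map_mat_transpose)
qed (use a c in \<open>simp_all add: spectrum_antidiag_conj spectrum_companion_norm_less_1[OF a]
      mult_carrier_mat[of _ n n]\<close>)

lemma stable_G_N:
  assumes a: "a \<in> carrier_vec n" "zeros_in_unit_disc (hat_poly a)"
    and c: "c \<in> carrier_vec n" "zeros_in_unit_disc (hat_poly c)"
  shows "stable_mat (G_N n a c)"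
  unfolding G_N_eq
  by (rule stable_mat_lower_block) (use a c in \<open>simp_all add: spectrum_antidiag_conj
      spectrum_companion_norm_less_1[OF a] spectrum_companion_norm_less_1[OF c] mult_carrier_mat[of _ n n]\<close>)

section \<open>Reachability\<close>

text \<open>Listed in this order, the coordinates of $\mathbb{R}^{2n}$ form a single shift register fed
  by \<open>e_P\<close>: \<open>G_N\<close> becomes upper Hessenberg with unit subdiagonal, and \<open>e_P\<close> becomes the first
  basis vector.\<close>

definition chain :: "nat \<Rightarrow> nat \<Rightarrow> nat" where
  "chain n m = (if m < n then n - 1 - m else m)"

lemma chain_less: "m < n + n \<Longrightarrow> chain n m < n + n"
  by (auto simp: chain_def)

lemma chain_chain: "chain n (chain n m) = m"
  by (auto simp: chain_def)

lemma e_P_index: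
  assumes "i < n + n"
  shows "e_P n $ i = (if i + 1 = n then 1 else 0)"
  using assms by (auto simp: e_P_def antidiag_mat_vec_index[of _ n] unit_vec_def
      simp del: index_mult_mat_vec)

text \<open>Row n - 1 holds the reversed coefficients of a. It belongs to position 0 of the chain,
  whereas the shift is only followed into positions \<open>Suc m\<close>, so it is left out.\<close>

lemma G_N_index:
  assumes "a \<in> carrier_vec n" "c \<in> carrier_vec n" "i < n + n" "j < n + n" "i + 1 \<noteq> n"
  shows "G_N n a c $$ (i, j) =
    (if i < n then if j = i + 1 then 1 else 0
     else if i = n then (if j = 0 then 1 else 0) - (if n \<le> j then c $ (j - n) else 0)
     else if j + 1 = i then 1 else 0)"
proof (cases "i < n \<and> j < n")
  case True
  then show ?thesis
    using assms antidiag_conj_index[of "companion n a" n i j]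
    by (auto simp: G_N_eq companion_index simp del: index_mult_mat(1))
next
  case False
  then show ?thesis
    using assms by (auto simp: G_N_eq companion_index)
qed

text \<open>Each cell receives the content of its predecessor in the chain. The one deviation is the
  feedback of c into position n, the first cell of the second register.\<close>

lemma G_N_mult_vec_chain:
  assumes a: "a \<in> carrier_vec n" and c: "c \<in> carrier_vec n" and x: "x \<in> carrier_vec (n + n)"
    and m: "Suc m < n + n"
  shows "(G_N n a c *\<^sub>v x) $ chain n (Suc m) =
    x $ chain n m - (if Suc m = n then \<Sum>j<n. c $ j * x $ (n + j) else 0)"
proof -
  let ?i = "chain n (Suc m)"
  have i: "?i < n + n" "?i + 1 \<noteq> n"
    using m by (auto simp: chain_def)
  have row: "(G_N n a c *\<^sub>v x) $ ?i = (\<Sum>j<n + n. G_N n a c $$ (?i, j) * x $ j)"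
    using mult_mat_vec_index[OF G_N_carrier[OF a c] x i(1)] .
  show ?thesis
  proof (cases "Suc m = n")
    case False
    have "G_N n a c $$ (?i, j) = (if j = chain n m then 1 else 0)" if "j < n + n" for j
      using G_N_index[OF a c i(1) that i(2)] False m by (auto simp: chain_def split: if_splits)
    then have "(\<Sum>j<n + n. G_N n a c $$ (?i, j) * x $ j) = (\<Sum>j<n + n. if j = chain n m then x $ j else 0)"
      by (intro sum.cong refl) simp
    then show ?thesis
      using False m chain_less[of m n] row by simp
  next
    case True
    then have "?i = n" "chain n m = 0"
      by (auto simp: chain_def)
    have "(\<Sum>j<n + n. G_N n a c $$ (n, j) * x $ j) =
        (\<Sum>j<n + n. (if j = 0 then x $ j else 0) - (if n \<le> j then c $ (j - n) * x $ j else 0))"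
      using True by (intro sum.cong refl) (auto simp: G_N_index[OF a c])
    also have "\<dots> = x $ 0 - (\<Sum>j<n + n. if n \<le> j then c $ (j - n) * x $ j else 0)"
      using True by (simp add: sum_subtractf)
    also have "(\<Sum>j<n + n. if n \<le> j then c $ (j - n) * x $ j else 0) = (\<Sum>j\<in>{n..<n + n}. c $ (j - n) * x $ j)"
      by (intro sum.mono_neutral_cong_right) auto
    also have "\<dots> = (\<Sum>j<n. c $ j * x $ (n + j))"
      by (rule sum.reindex_bij_witness[of _ "\<lambda>j. n + j" "\<lambda>j. j - n"]) auto
    finally show ?thesis
      using True row \<open>?i = n\<close> \<open>chain n m = 0\<close> by simp
  qed
qed

text \<open>After k steps the unit impulse has just reached position k and the later cells are still
  empty. Feedback affects only the earlier positions, about which nothing is claimed.\<close>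

lemma G_N_orbit_chain:
  assumes n: "1 \<le> n" and a: "a \<in> carrier_vec n" and c: "c \<in> carrier_vec n"
    and km: "k \<le> m" "m < n + n"
  shows "(G_N n a c ^\<^sub>m k *\<^sub>v e_P n) $ chain n m = (if m = k then 1 else 0)"
  using km
proof (induction k arbitrary: m)
  case 0
  have "G_N n a c ^\<^sub>m 0 *\<^sub>v e_P n = e_P n"
    using G_N_carrier[OF a c] e_P_carrier by simp
  then show ?case
    using 0 n by (auto simp: e_P_index chain_less chain_def)
next
  case (Suc k)
  let ?G = "G_N n a c"
  let ?x = "?G ^\<^sub>m k *\<^sub>v e_P n"
  have G: "?G \<in> carrier_mat (n + n) (n + n)"
    using a c by (rule G_N_carrier)
  have x: "?x \<in> carrier_vec (n + n)"
    using pow_carrier_mat[OF G] e_P_carrier by (rule mult_mat_vec_carrier)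
  obtain m' where m': "m = Suc m'"
    using Suc.prems by (cases m) auto
  have "?G ^\<^sub>m Suc k *\<^sub>v e_P n = ?G *\<^sub>v ?x"
    unfolding pow_mat_Suc_left[OF G] using G pow_carrier_mat[OF G] e_P_carrier by (rule assoc_mult_mat_vec)
  \<comment> \<open>The feedback reads positions n + j; here k < n, so by the induction hypothesis
    they are still 0.\<close>
  moreover have "(\<Sum>j<n. c $ j * ?x $ (n + j)) = 0" if "Suc m' = n"
  proof (intro sum.neutral ballI)
    fix j assume "j \<in> {..<n}"
    then show "c $ j * ?x $ (n + j) = 0"
      using Suc.IH[of "n + j"] Suc.prems that m' by (simp add: chain_def)
  qed
  moreover have "?x $ chain n m' = (if m = Suc k then 1 else 0)"
    using Suc.IH[of m'] Suc.prems m' by simp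
  ultimately show ?case
    using G_N_mult_vec_chain[OF a c x, of m'] Suc.prems m' by auto
qed

text \<open>In chain order the orbit vectors form a triangular system with unit diagonal. Against
  the m-th one, earlier positions drop out because w vanishes there by induction, later ones because
  the orbit vector does, which leaves the entry of w at position m.\<close>

lemma G_N_reachable:
  assumes n: "1 \<le> n" and a: "a \<in> carrier_vec n" and c: "c \<in> carrier_vec n"
    and w: "w \<in> carrier_vec (n + n)" and orth: "\<And>k. w \<bullet> (G_N n a c ^\<^sub>m k *\<^sub>v e_P n) = 0"
  shows "w = 0\<^sub>v (n + n)"
proof -
  have zero: "w $ chain n m = 0" if "m < n + n" for m
    using that
  proof (induction m rule: less_induct)
    case (less m)
    let ?x = "G_N n a c ^\<^sub>m m *\<^sub>v e_P n"
    have x: "dim_vec ?x = n + n"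
      using G_N_carrier[OF a c] by simp
    have "w $ i * ?x $ i = 0" if i: "i < n + n" "i \<noteq> chain n m" for i
    proof (cases "chain n i < m")
      case True
      then show ?thesis
        using less.IH[OF True] chain_less[OF i(1)] by (simp add: chain_chain)
    next
      case False
      then have "m < chain n i"
        using i chain_chain[of n i] by (metis linorder_neqE_nat)
      then show ?thesis
        using G_N_orbit_chain[OF n a c, of m "chain n i"] chain_less[OF i(1)] by (simp add: chain_chain)
    qed
    then have "(\<Sum>i<n + n. w $ i * ?x $ i) = (\<Sum>i\<in>{chain n m}. w $ i * ?x $ i)"
      using chain_less[OF less.prems] by (intro sum.mono_neutral_right) auto
    moreover have "(\<Sum>i<n + n. w $ i * ?x $ i) = 0"
      using orth[of m] x by (simp add: scalar_prod_def lessThan_atLeast0)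
    ultimately show ?case
      using G_N_orbit_chain[OF n a c, of m m] less.prems by simp
  qed
  have "w $ i = 0" if "i < n + n" for i
    using zero[OF chain_less[OF that]] by (simp add: chain_chain)
  then show ?thesis
    using w by (intro eq_vecI) auto
qed

section \<open>Entries of the Bezout matrix\<close>

text \<open>Multiplication by z shifts the coefficient array down one row, multiplication by w right
  one column, so the indices run up to n. The guards set entries outside the array to 0 and keep i -
  1 and j - 1 from truncating.\<close>

lemma power_diff_mult_double_sum:
  fixes b :: "nat \<Rightarrow> nat \<Rightarrow> real"
  shows "(z - w) * (\<Sum>i<n. \<Sum>j<n. b i j * z ^ i * w ^ j) =
    (\<Sum>i<Suc n. \<Sum>j<Suc n. ((if 0 < i \<and> j < n then b (i - 1) j else 0)
      - (if 0 < j \<and> i < n then b i (j - 1) else 0)) * w ^ j * z ^ i)"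
proof -
  have "(\<Sum>i<Suc n. \<Sum>j<Suc n. (if 0 < i \<and> j < n then b (i - 1) j else 0) * w ^ j * z ^ i) =
      (\<Sum>i<Suc n. \<Sum>j<n. (if 0 < i then b (i - 1) j else 0) * w ^ j * z ^ i)"
    by (rule sum.cong[OF refl]) simp
  also have "\<dots> = (\<Sum>i<n. \<Sum>j<n. b i j * w ^ j * z ^ Suc i)"
    by (subst sum.lessThan_Suc_shift) simp
  finally have "(\<Sum>i<Suc n. \<Sum>j<Suc n. (if 0 < i \<and> j < n then b (i - 1) j else 0) * w ^ j * z ^ i) =
      (\<Sum>i<n. \<Sum>j<n. b i j * w ^ j * z ^ Suc i)" .
  moreover have "(\<Sum>i<Suc n. \<Sum>j<Suc n. (if 0 < j \<and> i < n then b i (j - 1) else 0) * w ^ j * z ^ i) =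
      (\<Sum>i<n. \<Sum>j<Suc n. (if 0 < j then b i (j - 1) else 0) * w ^ j * z ^ i)"
    by (subst sum.lessThan_Suc) (simp del: sum.lessThan_Suc)
  moreover have "\<dots> = (\<Sum>i<n. \<Sum>j<n. b i j * w ^ Suc j * z ^ i)"
    by (rule sum.cong[OF refl], subst sum.lessThan_Suc_shift) simp
  ultimately show ?thesis
    by (simp only: left_diff_distrib sum_subtractf) (simp add: sum_distrib_left mult_ac)
qed

text \<open>Both sides are the coefficient of z^i w^j in the identity that defines the Bezout
  matrix.\<close>

lemma bezout_coeff:
  assumes deg: "degree p \<le> n" "degree q \<le> n" and B: "is_bezout_mat n p q B"
    and ij: "i \<le> n" "j \<le> n"
  shows "coeff p i * coeff q j - coeff p j * coeff q i =
    (if 0 < i \<and> j < n then B $$ (i - 1, j) else 0) - (if 0 < j \<and> i < n then B $$ (i, j - 1) else 0)"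
    (is "?l i j = ?r i j")
proof -
  have car: "B \<in> carrier_mat n n"
    using B by (simp add: is_bezout_mat_def)
  have "(\<Sum>i<Suc n. (\<Sum>j<Suc n. (?l i j - ?r i j) * w ^ j) * z ^ i) = 0" for z w
  proof -
    have "poly p z * poly q w = (\<Sum>i<Suc n. \<Sum>j<Suc n. coeff p i * coeff q j * w ^ j * z ^ i)"
      unfolding poly_altdef_le[OF deg(1)] poly_altdef_le[OF deg(2)] lessThan_Suc_atMost sum_product
      by (simp add: mult_ac)
    moreover have "poly p w * poly q z = (\<Sum>i<Suc n. \<Sum>j<Suc n. coeff p j * coeff q i * w ^ j * z ^ i)"
      unfolding poly_altdef_le[OF deg(1)] poly_altdef_le[OF deg(2)] lessThan_Suc_atMost sum_product
      by (subst sum.swap) (simp add: mult_ac)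
    ultimately have "poly p z * poly q w - poly p w * poly q z =
        (\<Sum>i<Suc n. \<Sum>j<Suc n. ?l i j * w ^ j * z ^ i)"
      by (simp only: left_diff_distrib sum_subtractf)
    moreover have "poly p z * poly q w - poly p w * poly q z =
        (\<Sum>i<Suc n. \<Sum>j<Suc n. ?r i j * w ^ j * z ^ i)"
      using B unfolding is_bezout_mat_def power_vec_bilinear[OF car] power_diff_mult_double_sum by blast
    ultimately show ?thesis
      by (simp only: left_diff_distrib sum_subtractf sum_distrib_right)
  qed
  \<comment> \<open>Coefficients are compared first in z for each fixed w, then in w.\<close>
  then have "(\<Sum>j<Suc n. (?l i j - ?r i j) * w ^ j) = 0" for w
    by (rule coeffs_eq_0_if_vanishing[where w = 0]) (use ij in auto)
  then have "?l i j - ?r i j = 0"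
    by (rule coeffs_eq_0_if_vanishing[where w = 0]) (use ij in auto)
  then show ?thesis by simp
qed

text \<open>Exchanging z and w changes the sign of both sides of the defining identity, so the
  transpose satisfies it as well, and uniqueness applies.\<close>

lemma bezout_mat_symmetric:
  assumes B: "is_bezout_mat n p q B"
  shows "transpose_mat B = B"
proof (rule bezout_mat_unique[OF _ B])
  have car: "B \<in> carrier_mat n n" "transpose_mat B \<in> carrier_mat n n"
    using B by (auto simp: is_bezout_mat_def)
  have "poly p z * poly q w - poly p w * poly q z =
      (z - w) * (\<Sum>i<n. \<Sum>j<n. transpose_mat B $$ (i, j) * z ^ i * w ^ j)" for z w
  proof -
    have "poly p w * poly q z - poly p z * poly q w =
        (w - z) * (\<Sum>i<n. \<Sum>j<n. B $$ (i, j) * w ^ i * z ^ j)"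
      using B unfolding is_bezout_mat_def power_vec_bilinear[OF car(1)] by blast
    also have "(\<Sum>i<n. \<Sum>j<n. B $$ (i, j) * w ^ i * z ^ j) =
        (\<Sum>i<n. \<Sum>j<n. transpose_mat B $$ (i, j) * z ^ i * w ^ j)"
      using car by (subst sum.swap) (simp add: mult_ac)
    finally show ?thesis
      by (simp add: algebra_simps)
  qed
  then show "is_bezout_mat n p q (transpose_mat B)"
    using car unfolding is_bezout_mat_def power_vec_bilinear[OF car(2)] by blast
qed

lemma coeff_rev_poly:
  assumes "a \<in> carrier_vec n"
  shows "coeff (rev_poly a) 0 = 1" "i < n \<Longrightarrow> coeff (rev_poly a) (Suc i) = a $ i"
  using assms by (auto simp: rev_poly_def coeff_sum sum.delta)

text \<open>These are the coefficients at (i + 1, 0) and (i + 1, j + 1); the first uses that both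
  constant terms are 1. In matrix form they read B e = c - a and B J - J^T B = c a^T - a
  c^T.\<close>

lemma
  assumes a: "a \<in> carrier_vec n" and c: "c \<in> carrier_vec n"
    and B: "is_bezout_mat n (rev_poly c) (rev_poly a) B"
  shows bezout_first_col: "i < n \<Longrightarrow> B $$ (i, 0) = c $ i - a $ i"
    and bezout_shift: "i < n \<Longrightarrow> j < n \<Longrightarrow>
      (if Suc j < n then B $$ (i, Suc j) else 0) - (if Suc i < n then B $$ (Suc i, j) else 0) =
      c $ i * a $ j - c $ j * a $ i"
proof -
  have deg: "degree (rev_poly c) \<le> n" "degree (rev_poly a) \<le> n"
    using degree_rev_poly[of a] degree_rev_poly[of c] a c by auto
  note * = bezout_coeff[OF deg B]
  show "B $$ (i, 0) = c $ i - a $ i" if "i < n"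
    using *[of "Suc i" 0] that by (simp add: coeff_rev_poly[OF a] coeff_rev_poly[OF c])
  show "(if Suc j < n then B $$ (i, Suc j) else 0) - (if Suc i < n then B $$ (Suc i, j) else 0) =
      c $ i * a $ j - c $ j * a $ i" if "i < n" "j < n"
    using *[of "Suc i" "Suc j"] that by (simp add: coeff_rev_poly[OF a] coeff_rev_poly[OF c])
qed

text \<open>With B e = c - a, the rank-one parts contribute -(c - a) c^T to the right side and -c (c
  - a)^T to the left. The terms c c^T agree, and the rest balances B J - J^T B = c a^T - a
  c^T.\<close>

lemma transpose_companion_mult_bezout:
  assumes a: "a \<in> carrier_vec n" and c: "c \<in> carrier_vec n"
    and B: "is_bezout_mat n (rev_poly c) (rev_poly a) B"
  shows "transpose_mat (companion n c) * B = B * companion n c"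
proof
  have car: "B \<in> carrier_mat n n"
    using B by (simp add: is_bezout_mat_def)
  have C: "companion n c \<in> carrier_mat n n"
    using c by simp
  fix i j assume "i < dim_row (B * companion n c)" "j < dim_col (B * companion n c)"
  then have ij: "i < n" "j < n"
    using car C by auto
  have n: "0 < n"
    using ij by simp
  \<comment> \<open>Symmetry turns the formula for the first column into one for the first
    row.\<close>
  have B0: "B $$ (0, j) = B $$ (j, 0)"
    using arg_cong[OF bezout_mat_symmetric[OF B], of "\<lambda>M. M $$ (j, 0)"] car ij n by simp
  have "(transpose_mat (companion n c) * B) $$ (i, j) = (\<Sum>k<n. companion n c $$ (k, i) * B $$ (k, j))"
    using car c ij by (simp add: scalar_prod_def lessThan_atLeast0)
  also have "\<dots> = (\<Sum>k<n. (if k = Suc i then B $$ (k, j) else 0) - (if k = 0 then c $ i * B $$ (k, j) else 0))"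
    using ij by (intro sum.cong refl) (auto simp: companion_index[OF c])
  also have "\<dots> = (if Suc i < n then B $$ (Suc i, j) else 0) - c $ i * B $$ (0, j)"
    using n by (simp add: sum_subtractf)
  also have "\<dots> = (if Suc j < n then B $$ (i, Suc j) else 0) - c $ j * B $$ (i, 0)"
    using bezout_shift[OF a c B ij] ij
    by (simp add: B0 bezout_first_col[OF a c B] algebra_simps)
  also have "\<dots> = (\<Sum>k<n. (if k = Suc j then B $$ (i, k) else 0) - (if k = 0 then c $ j * B $$ (i, k) else 0))"
    using n by (simp add: sum_subtractf)
  also have "\<dots> = (\<Sum>k<n. B $$ (i, k) * companion n c $$ (k, j))"
    using ij by (intro sum.cong refl) (auto simp: companion_index[OF c])
  also have "\<dots> = (B * companion n c) $$ (i, j)"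
    using car c ij by (simp add: scalar_prod_def lessThan_atLeast0)
  finally show "(transpose_mat (companion n c) * B) $$ (i, j) = (B * companion n c) $$ (i, j)" .
qed (use c B in \<open>auto simp: is_bezout_mat_def\<close>)

section \<open>Factorization of the Stein solution\<close>

text \<open>Blockwise, the upper rows agree at once, the lower left block is B e e^T = (c - a) e^T,
  and the lower right one is \<open>transpose_companion_mult_bezout\<close>.\<close>

lemma F_M_intertwines_G_N:
  assumes a: "a \<in> carrier_vec n" and c: "c \<in> carrier_vec n"
    and B: "is_bezout_mat n (rev_poly c) (rev_poly a) B"
  defines "D \<equiv> four_block_mat (1\<^sub>m n) (0\<^sub>m n n) (0\<^sub>m n n) B"
  shows "F_M n a c * D = D * G_N n a c"
proof -
  let ?A = "antidiag_mat n * companion n a * antidiag_mat n"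
  let ?e = "unit_vec n 0 :: real vec"
  have car: "B \<in> carrier_mat n n" "?A \<in> carrier_mat n n"
    using B a by (auto simp: is_bezout_mat_def intro!: carrier_matI)
  have out: "outer (c - a) ?e \<in> carrier_mat n n" "outer ?e ?e \<in> carrier_mat n n"
    using a c by auto
  have "B * outer ?e ?e = outer (c - a) ?e"
  proof
    fix i j assume "i < dim_row (outer (c - a) ?e)" "j < dim_col (outer (c - a) ?e)"
    then have ij: "i < n" "j < n" using a by auto
    have "(B * outer ?e ?e) $$ (i, j) = (\<Sum>k<n. B $$ (i, k) * outer ?e ?e $$ (k, j))"
      using ij car by (simp add: scalar_prod_def lessThan_atLeast0)
    also have "\<dots> = (\<Sum>k<n. if k = 0 then B $$ (i, k) * ?e $ j else 0)"
      using ij by (intro sum.cong) auto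
    also have "\<dots> = B $$ (i, 0) * ?e $ j"
      using ij by simp
    also have "\<dots> = outer (c - a) ?e $$ (i, j)"
      using ij a c bezout_first_col[OF a c B ij(1)] by simp
    finally show "(B * outer ?e ?e) $$ (i, j) = outer (c - a) ?e $$ (i, j)" .
  qed (use a car in auto)
  moreover have "F_M n a c * D = four_block_mat (?A * 1\<^sub>m n + 0\<^sub>m n n * 0\<^sub>m n n) (?A * 0\<^sub>m n n + 0\<^sub>m n n * B)
      (outer (c - a) ?e * 1\<^sub>m n + transpose_mat (companion n c) * 0\<^sub>m n n)
      (outer (c - a) ?e * 0\<^sub>m n n + transpose_mat (companion n c) * B)"
    unfolding F_M_eq[OF a c] D_def using car out c by (intro mult_four_block_mat) auto
  moreover have "D * G_N n a c = four_block_mat (1\<^sub>m n * ?A + 0\<^sub>m n n * outer ?e ?e) (1\<^sub>m n * 0\<^sub>m n n + 0\<^sub>m n n * companion n c)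
      (0\<^sub>m n n * ?A + B * outer ?e ?e) (0\<^sub>m n n * 0\<^sub>m n n + B * companion n c)"
    unfolding G_N_eq D_def using car out c by (intro mult_four_block_mat) auto
  moreover have "B * companion n c \<in> carrier_mat n n" "transpose_mat (companion n c) \<in> carrier_mat n n"
    using car c by auto
  ultimately show ?thesis
    using car out carrier_vecD[OF a] carrier_vecD[OF c] transpose_companion_mult_bezout[OF a c B]
    by (simp del: index_mult_mat assoc_mult_mat)
qed

text \<open>\<open>e_P\<close> lives in the upper half, where the block diagonal matrix acts as the
  identity.\<close>

lemma block_diag_mult_e_P:
  assumes "B \<in> carrier_mat n n"
  shows "four_block_mat (1\<^sub>m n) (0\<^sub>m n n) (0\<^sub>m n n) B *\<^sub>v e_P n = e_P n"
proof -
  have v: "antidiag_mat n *\<^sub>v unit_vec n 0 \<in> carrier_vec n"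
    by (rule mult_mat_vec_carrier) auto
  have "B *\<^sub>v 0\<^sub>v n = 0\<^sub>v n"
    using assms by (intro eq_vecI) (auto simp: scalar_prod_def)
  then show ?thesis
    unfolding e_P_def using mult_mat_vec_split[OF one_carrier_mat assms v zero_carrier_vec] v by simp
qed

lemma outer_mult_mat_vec:
  assumes "D \<in> carrier_mat m n" "u \<in> carrier_vec n" "v \<in> carrier_vec n"
  shows "outer (D *\<^sub>v u) (D *\<^sub>v v) = D * outer u v * transpose_mat D"
proof
  fix i j assume "i < dim_row (D * outer u v * transpose_mat D)" "j < dim_col (D * outer u v * transpose_mat D)"
  then have ij: "i < m" "j < m" using assms by auto
  have "outer (D *\<^sub>v u) (D *\<^sub>v v) $$ (i, j) = (\<Sum>p<n. \<Sum>q<n. (D $$ (i, p) * u $ p) * (D $$ (j, q) * v $ q))"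
    using assms ij by (simp add: scalar_prod_def lessThan_atLeast0 sum_product)
  also have "\<dots> = (\<Sum>q<n. \<Sum>p<n. (D $$ (i, p) * u $ p) * (D $$ (j, q) * v $ q))"
    by (rule sum.swap)
  also have "\<dots> = (D * outer u v * transpose_mat D) $$ (i, j)"
  proof -
    have "D * outer u v \<in> carrier_mat m n"
      using assms by (intro mult_carrier_mat) auto
    then have "(D * outer u v * transpose_mat D) $$ (i, j) = (\<Sum>q<n. (D * outer u v) $$ (i, q) * D $$ (j, q))"
      using assms ij index_mult_mat(1)[of i "D * outer u v" j "transpose_mat D"]
      by (simp add: scalar_prod_def lessThan_atLeast0 del: index_mult_mat(1))
    then show ?thesis
      using assms ij by (simp add: scalar_prod_def lessThan_atLeast0 sum_distrib_left mult_ac)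
  qed
  finally show "outer (D *\<^sub>v u) (D *\<^sub>v v) $$ (i, j) = (D * outer u v * transpose_mat D) $$ (i, j)" .
qed (use assms in auto)

text \<open>Multiplying the equation for X by D and D^T, the relation F D = D G moves D inside: D G
  X G^T D^T = F (D X D^T) F^T.\<close>

lemma stein_solution_congruence:
  assumes car: "D \<in> carrier_mat n n" "F \<in> carrier_mat n n" "G \<in> carrier_mat n n" "g \<in> carrier_vec n"
    and int: "F * D = D * G" and X: "stein_solution G g X"
  shows "stein_solution F (D *\<^sub>v g) (D * X * transpose_mat D)"
proof -
  have Xc: "X \<in> carrier_mat n n" and X_eq: "X = G * X * transpose_mat G + outer g g"
    using X car unfolding stein_solution_def by auto
  have out: "outer g g \<in> carrier_mat n n"
    using car by simp
  have "D * X * transpose_mat D = D * (G * X * transpose_mat G + outer g g) * transpose_mat D"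
    using X_eq by simp
  also have "\<dots> = (D * G) * X * (transpose_mat G * transpose_mat D) + D * outer g g * transpose_mat D"
    using car Xc out by (simp add: mult_add_distrib_mat[of _ n n _ n] add_mult_distrib_mat[of _ n n _ _ n]
        assoc_mult_mat[of _ n n _ n _ n])
  also have "transpose_mat G * transpose_mat D = transpose_mat (D * G)"
    using car by (simp add: transpose_mult[of _ n n _ n])
  also have "(D * G) * X * transpose_mat (D * G) = F * (D * X * transpose_mat D) * transpose_mat F"
    unfolding int[symmetric] using car Xc
    by (simp add: transpose_mult[of _ n n _ n] assoc_mult_mat[of _ n n _ n _ n])
  also have "D * outer g g * transpose_mat D = outer (D *\<^sub>v g) (D *\<^sub>v g)"
    using outer_mult_mat_vec[OF car(1,4,4)] by simp
  finally show ?thesis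
    using car Xc unfolding stein_solution_def by auto
qed

theorem proposition5p1:
  fixes n :: nat and a c :: "real vec"
  assumes "n \<ge> 1"
    and "a \<in> carrier_vec n" and "c \<in> carrier_vec n"
    and "zeros_in_unit_disc (hat_poly a)" and "zeros_in_unit_disc (hat_poly c)"
  shows "(\<exists>!H. stein_solution (F_M n a c) (e_P n) H) \<and>
    (\<exists>!Q. stein_solution (G_N n a c) (e_P n) Q) \<and>
    pos_definite (Q_mat n a c) \<and>
    (let B = bezout_mat n (rev_poly c) (rev_poly a);
         D = four_block_mat (1\<^sub>m n) (0\<^sub>m n n) (0\<^sub>m n n) B
     in H_mat n a c = D * Q_mat n a c * D)"
proof -
  note a = assms(2,4) and c = assms(3,5)
  define B where "B = bezout_mat n (rev_poly c) (rev_poly a)"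
  define D where "D = four_block_mat (1\<^sub>m n) (0\<^sub>m n n) (0\<^sub>m n n) B"
  have B: "is_bezout_mat n (rev_poly c) (rev_poly a) B"
    unfolding B_def by (rule is_bezout_mat_bezout_mat[OF a(1) c(1)])
  then have Bc: "B \<in> carrier_mat n n"
    by (simp add: is_bezout_mat_def)
  then have Dc: "D \<in> carrier_mat (n + n) (n + n)"
    by (simp add: D_def)
  \<comment> \<open>Symmetry of D lets the congruence D Q D^T take the form D Q D.\<close>
  have DT: "transpose_mat D = D"
    unfolding D_def using Bc bezout_mat_symmetric[OF B]
    by (simp add: transpose_four_block_mat[of _ n n _ n _ n])
  note F = stable_F_M[OF a c] F_M_carrier[OF a(1) c(1)]
  note G = stable_G_N[OF a c] G_N_carrier[OF a(1) c(1)]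
  let ?Q = "gramian (G_N n a c) (e_P n)"
  have Q: "stein_solution (G_N n a c) (e_P n) ?Q"
    by (rule stein_solution_gramian[OF G e_P_carrier])
  have Q_eq: "Q_mat n a c = ?Q"
    unfolding Q_mat_def by (rule stein_solution_the_eq[OF G e_P_carrier Q])
  have "stein_solution (F_M n a c) (D *\<^sub>v e_P n) (D * ?Q * transpose_mat D)"
    using F_M_intertwines_G_N[OF a(1) c(1) B] Q unfolding D_def[symmetric]
    by (rule stein_solution_congruence[OF Dc F(2) G(2) e_P_carrier])
  \<comment> \<open>As D fixes \<open>e_P\<close>, the transformed equation has the input of the
    equation for H, and uniqueness identifies the two solutions.\<close>
  then have "stein_solution (F_M n a c) (e_P n) (D * ?Q * D)"
    unfolding DT using block_diag_mult_e_P[OF Bc] unfolding D_def by simp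
  then have "H_mat n a c = D * Q_mat n a c * D"
    unfolding H_mat_def Q_eq by (rule stein_solution_the_eq[OF F e_P_carrier])
  moreover have "pos_definite (Q_mat n a c)"
    unfolding Q_eq using G_N_reachable[OF assms(1) a(1) c(1)]
    by (rule pos_definite_gramian[OF G e_P_carrier])
  ultimately show ?thesis
    using ex1_stein_solution[OF F e_P_carrier] ex1_stein_solution[OF G e_P_carrier]
    unfolding Let_def D_def B_def by blast
qed

end
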